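(* Let $E_1(n)$ and $E_4(n)$ be the Benford errors for the digits $1$ and $4$ of the sequence $\{2^n\}$, and let $\alpha=\log_{10}2$. For any real numbers $s<t$, $$\lim_{N\to\infty}\frac1N\#\{n\le N: s\le E_i(n)<t\}=\int_s^t f_i(x)\,dx\qquad(i=1,4),$$ where $$f_1(x)=\begin{cases}1&\text{if } -1\le x\le 0,\\ 0&\text{otherwise,}\end{cases}$$ $$f_4(x)=\begin{cases}1/3&\text{if } 3\alpha-1\le x<0 \text{ or } 1\le x<2-3\alpha,\\ 2/3&\text{if } 0\le x<1-3\alpha \text{ or } 3\alpha\le x<1,\\ 1&\text{if } 1-3\alpha\le x<3\alpha,\\ 0&\text{otherwise.}\end{cases}$$
   Context: "$n\le N$" means $n$ runs over the integers $1,2,\dots,N$. For a real number $x>0$, $D(x)\in\{1,\dots,9\}$ denotes the leading (most significant) decimal digit of $x$, ignoring leading zeros. For $d\in\{1,\dots,9\}$ and a positive integer $N$, the Benford error of the sequence $\{2^n\}_{n\ge1}$ is $$E_d(N)=\#\{n\le N: D(2^n)=d\}-N\log_{10}\left(1+\tfrac1d\right).$$ *)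

theory Defs
  imports "HOL-Analysis.Analysis"
begin

text \<open>For \<open>x > 0\<close>, division by \<open>10 powi \<lfloor>log 10 x\<rfloor>\<close> normalises \<open>x\<close> to its significand in \<open>[1, 10)\<close>,
  whose integer part is the most significant decimal digit. The argument is real and may be
  less than 1, so the exponent is an integer.\<close>

definition leading_digit :: "real \<Rightarrow> nat" where
  "leading_digit x = nat \<lfloor>x / 10 powi \<lfloor>log 10 x\<rfloor>\<rfloor>"

lemma leading_digit_bounds:
  assumes "x > 0"
  shows "1 \<le> x / 10 powi \<lfloor>log 10 x\<rfloor>" and "x / 10 powi \<lfloor>log 10 x\<rfloor> < 10"
proof -
  define k where "k = \<lfloor>log 10 x\<rfloor>"
  have k: "of_int k \<le> log 10 x" "log 10 x < of_int k + 1"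
    unfolding k_def by linarith+
  have p: "10 powi k = (10::real) powr of_int k"
    by (simp add: powr_real_of_int')
  have "10 powr of_int k \<le> x"
    using k(1) assms by (simp add: le_log_iff)
  moreover have "x < 10 powr (of_int k + 1)"
    using k(2) assms by (simp add: log_less_iff)
  ultimately show "1 \<le> x / 10 powi \<lfloor>log 10 x\<rfloor>" "x / 10 powi \<lfloor>log 10 x\<rfloor> < 10"
    unfolding k_def[symmetric] p by (simp_all add: powr_add field_simps)
qed

lemma leading_digit_range:
  assumes "x > 0"
  shows "leading_digit x \<in> {1..9}"
  using leading_digit_bounds[OF assms]
  unfolding leading_digit_def atLeastAtMost_iff by linarith

definition benford_error :: "nat \<Rightarrow> nat \<Rightarrow> real" where
  "benford_error d N =
     real (card {n \<in> {1..N}. leading_digit (2 ^ n) = d}) - real N * log 10 (1 + 1 / real d)"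

definition alpha :: real where
  "alpha = log 10 2"

definition f1 :: "real \<Rightarrow> real" where
  "f1 x = (if -1 \<le> x \<and> x \<le> 0 then 1 else 0)"

definition f4 :: "real \<Rightarrow> real" where
  "f4 x =
    (if (3 * alpha - 1 \<le> x \<and> x < 0) \<or> (1 \<le> x \<and> x < 2 - 3 * alpha) then 1 / 3
     else if (0 \<le> x \<and> x < 1 - 3 * alpha) \<or> (3 * alpha \<le> x \<and> x < 1) then 2 / 3
     else if 1 - 3 * alpha \<le> x \<and> x < 3 * alpha then 1
     else 0)"

end

theory Submission
  imports Defs "HOL-Analysis.Kronecker_Approximation_Theorem"
begin

text \<open>
  Write \<open>v n\<close> for \<open>frac (n * alpha)\<close>. The number \<open>2 ^ n\<close> has leading digit \<open>d\<close> exactly when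
  \<open>v n\<close> lies in the interval from \<open>log 10 d\<close> to \<open>log 10 (d + 1)\<close>, so the Benford error is the
  discrepancy of an interval under the rotation of the circle by \<open>alpha\<close>. The indicator of an
  interval minus its length is a difference of two shifted copies of \<open>frac\<close>, namely
  \<open>frac (u - b) - frac (u - a)\<close> for the interval from \<open>a\<close> to \<open>b\<close>
  (lemma \<open>of_bool_frac_mem_interval\<close>). This identity is used twice.

  First, for the digits \<open>1\<close> and \<open>4\<close> the endpoints differ by a multiple of \<open>alpha\<close> modulo 1:
  they are \<open>0\<close> and \<open>alpha\<close>, respectively \<open>2 * alpha\<close> and \<open>1 - alpha\<close>. The sum
  over \<open>n\<close> therefore telescopes, and the error becomes a bounded function of \<open>v N\<close> alone:
  \<open>- v N\<close> for the digit \<open>1\<close>, and \<open>v (N - 1) + v N + v (N + 1) - 1\<close> for the digit \<open>4\<close>.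
  The latter is piecewise affine in \<open>v N\<close> with slope \<open>3\<close> on three pieces.

  Second, the identity reduces the equidistribution of \<open>v n\<close> to the statement that the mean of
  \<open>frac (n * alpha + x)\<close> over \<open>n \<le> N\<close> depends on \<open>x\<close> only up to an error tending to 0. Replacing
  \<open>x\<close> by \<open>x + k * alpha\<close> merely shifts the index by \<open>k\<close>, and by Kronecker's theorem such points
  come arbitrarily close to any prescribed \<open>y\<close> from below modulo 1, where
  \<open>frac\<close> increases by at most the distance.

  An affine piece of slope \<open>k\<close> then contributes the density \<open>1 / k\<close> on its image. For the digit
  \<open>1\<close> the image is the unit interval below 0. For the digit \<open>4\<close> there are three overlapping images,
  and \<open>f4\<close> counts, up to the factor \<open>1 / 3\<close>, how many of them contain a point.
\<close>

section \<open>Equidistribution of the multiples of an irrational number\<close>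

lemma frac_diff_of_bool:
  fixes u c :: real
  assumes "0 \<le> c" "c \<le> 1"
  shows "frac (u - c) = frac u - c + of_bool (frac u < c)"
proof -
  have "frac (u - c) = frac u - c + 1" if "frac u < c"
  proof -
    have "u - c - (frac u - c + 1) = of_int (\<lfloor>u\<rfloor> - 1)"
      by (simp add: frac_def)
    then have "u - c - (frac u - c + 1) \<in> \<int>"
      by (simp only: Ints_of_int)
    then show ?thesis
      unfolding frac_unique_iff using that assms frac_ge_0[of u] by linarith
  qed
  moreover have "frac (u - c) = frac u - c" if "\<not> frac u < c"
  proof -
    have "u - c - (frac u - c) = of_int \<lfloor>u\<rfloor>"
      by (simp add: frac_def)
    then have "u - c - (frac u - c) \<in> \<int>"
      by (simp only: Ints_of_int)
    then show ?thesis
      unfolding frac_unique_iff using that assms frac_lt_1[of u] by linarith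
  qed
  ultimately show ?thesis by auto
qed

text \<open>
  Passing from \<open>u\<close> to \<open>u - c\<close> lowers \<open>frac\<close> by \<open>c\<close>, except that points below \<open>c\<close> wrap around and gain 1.
  Each endpoint thus contributes a translate of the same function \<open>frac\<close>, and sums of indicators
  along an orbit become differences of sums of \<open>frac\<close> along two translated orbits.
\<close>

lemma of_bool_frac_mem_interval:
  fixes u a b :: real
  assumes "0 \<le> a" "a \<le> b" "b \<le> 1"
  shows "of_bool (a \<le> frac u \<and> frac u < b) = b - a + (frac (u - b) - frac (u - a))"
  using assms by (auto simp: frac_diff_of_bool)

lemma frac_add_le:
  fixes u h :: real
  assumes "0 \<le> h"
  shows "frac (u + h) \<le> frac u + h"
proof -
  have "\<lfloor>u\<rfloor> \<le> \<lfloor>u + h\<rfloor>"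
    using assms by (intro floor_mono) simp
  then show ?thesis
    by (simp add: frac_def)
qed

text \<open>
  Translating by \<open>\<theta>\<close> shifts the index of summation by one, which exchanges a single term of the
  sum for another one, and all terms lie in the unit interval.
\<close>

lemma abs_sum_frac_rotate_le:
  fixes \<theta> x :: real
  shows "\<bar>(\<Sum>n=1..N. frac (real n * \<theta> + (x + real k * \<theta>))) - (\<Sum>n=1..N. frac (real n * \<theta> + x))\<bar> \<le> real k"
proof (induction k)
  case (Suc k)
  define f where "f j = frac (real j * \<theta> + (x + real k * \<theta>))" for j :: nat
  have "(\<Sum>n=1..N. frac (real n * \<theta> + (x + real (Suc k) * \<theta>))) - (\<Sum>n=1..N. f n) =
        (\<Sum>n=1..N. f (Suc n) - f n)"
    unfolding sum_subtractf by (simp add: f_def algebra_simps)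
  also have "\<dots> = f (Suc N) - f 1"
    by (subst sum_Suc_diff) auto
  also have "\<bar>\<dots>\<bar> \<le> 1"
    using frac_ge_0 frac_lt_1 unfolding f_def by (smt (verit))
  finally show ?case
    using Suc.IH unfolding f_def by simp
qed simp

text \<open>
  The constant \<open>k\<close> is independent of \<open>N\<close>. It is chosen so that \<open>x + k * \<theta>\<close> lies below \<open>y\<close>
  modulo 1 by some \<open>h\<close> between 0 and \<open>\<epsilon>\<close>. The approximation has to be one-sided because
  \<open>frac\<close> has downward jumps: moving to the right increases it by at most the distance moved, while
  moving to the left may increase it by almost 1.
\<close>

lemma sum_frac_shift_le:
  fixes \<theta> x y \<epsilon> :: real
  assumes "\<theta> \<notin> \<rat>" "\<epsilon> > 0"
  obtains k :: nat where
    "\<And>N. (\<Sum>n=1..N. frac (real n * \<theta> + y)) \<le> (\<Sum>n=1..N. frac (real n * \<theta> + x)) + real k + real N * \<epsilon>"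
proof -
  \<comment> \<open>Aiming \<open>\<epsilon> / 2\<close> below the target with tolerance \<open>\<epsilon> / 2\<close> makes the error one-sided.\<close>
  define a where "a = frac (y - x - \<epsilon> / 2)"
  have "0 \<le> a" "a \<le> 1"
    unfolding a_def using frac_lt_1 less_imp_le by auto
  then obtain k :: nat where k: "\<bar>frac (real k * \<theta>) - a\<bar> < \<epsilon> / 2"
    using Kronecker_approx_1_explicit[OF assms(1), of a "\<epsilon> / 2"] assms(2) by auto
  define h where "h = \<epsilon> / 2 - (frac (real k * \<theta>) - a)"
  define m where "m = \<lfloor>y - x - \<epsilon> / 2\<rfloor> - \<lfloor>real k * \<theta>\<rfloor>"
  have h: "0 \<le> h" "h \<le> \<epsilon>"
    using k unfolding h_def by linarith+
  have y: "y = x + real k * \<theta> + h + of_int m"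
    unfolding h_def m_def a_def frac_def by simp
  have "(\<Sum>n=1..N. frac (real n * \<theta> + y)) \<le> (\<Sum>n=1..N. frac (real n * \<theta> + x)) + real k + real N * \<epsilon>" for N
  proof -
    have "frac (real n * \<theta> + y) \<le> frac (real n * \<theta> + (x + real k * \<theta>)) + \<epsilon>" for n
    proof -
      have "frac (real n * \<theta> + y) = frac ((real n * \<theta> + (x + real k * \<theta>)) + h)"
        by (metis (no_types, lifting) y add.assoc frac_add_of_int_right)
      also have "\<dots> \<le> frac (real n * \<theta> + (x + real k * \<theta>)) + h"
        by (rule frac_add_le[OF h(1)])
      finally show ?thesis using h(2) by simp
    qed
    then have "(\<Sum>n=1..N. frac (real n * \<theta> + y)) \<le> (\<Sum>n=1..N. frac (real n * \<theta> + (x + real k * \<theta>)) + \<epsilon>)"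
      by (rule sum_mono)
    also have "\<dots> = (\<Sum>n=1..N. frac (real n * \<theta> + (x + real k * \<theta>))) + real N * \<epsilon>"
      by (simp add: sum.distrib)
    finally show ?thesis
      using abs_sum_frac_rotate_le[where \<theta> = \<theta> and x = x and N = N and k = k] by linarith
  qed
  with that show thesis by blast
qed

lemma mean_frac_shift_diff_tendsto_0:
  fixes \<theta> x y :: real
  assumes "\<theta> \<notin> \<rat>"
  shows "(\<lambda>N. ((\<Sum>n=1..N. frac (real n * \<theta> + y)) - (\<Sum>n=1..N. frac (real n * \<theta> + x))) / real N)
           \<longlonglongrightarrow> 0"
proof (rule LIMSEQ_I)
  fix \<epsilon> :: real
  assume "\<epsilon> > 0"
  then have "\<epsilon> / 2 > 0" by simp
  obtain k where k:
    "\<And>N. (\<Sum>n=1..N. frac (real n * \<theta> + y)) \<le> (\<Sum>n=1..N. frac (real n * \<theta> + x)) + real k + real N * (\<epsilon> / 2)"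
    using sum_frac_shift_le[OF assms \<open>\<epsilon> / 2 > 0\<close>] by metis
  obtain l where l:
    "\<And>N. (\<Sum>n=1..N. frac (real n * \<theta> + x)) \<le> (\<Sum>n=1..N. frac (real n * \<theta> + y)) + real l + real N * (\<epsilon> / 2)"
    using sum_frac_shift_le[OF assms \<open>\<epsilon> / 2 > 0\<close>] by metis
  obtain M :: nat where M: "2 * (real k + real l) / \<epsilon> < real M"
    using reals_Archimedean2 by blast
  have "norm (((\<Sum>n=1..N. frac (real n * \<theta> + y)) - (\<Sum>n=1..N. frac (real n * \<theta> + x))) / real N - 0) < \<epsilon>"
    if "N \<ge> M" for N
  proof -
    have N: "real k + real l < real N * (\<epsilon> / 2)"
    proof -
      have "2 * (real k + real l) / \<epsilon> < real N" using M that by linarith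
      then show ?thesis using \<open>\<epsilon> > 0\<close> by (simp add: field_simps)
    qed
    have "real N > 0"
      using N by (cases N) auto
    moreover have "\<bar>(\<Sum>n=1..N. frac (real n * \<theta> + y)) - (\<Sum>n=1..N. frac (real n * \<theta> + x))\<bar> < real N * \<epsilon>"
      using k[of N] l[of N] N by (simp add: abs_less_iff)
    ultimately show ?thesis
      by (simp add: abs_divide field_simps)
  qed
  then show "\<exists>M. \<forall>N\<ge>M. norm (((\<Sum>n=1..N. frac (real n * \<theta> + y)) - (\<Sum>n=1..N. frac (real n * \<theta> + x))) / real N - 0) < \<epsilon>"
    by blast
qed

definition proportion :: "(nat \<Rightarrow> bool) \<Rightarrow> nat \<Rightarrow> real" where
  "proportion P N = real (card {n \<in> {1..N}. P n}) / real N"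

lemma card_filter_eq_sum:
  fixes P :: "nat \<Rightarrow> bool"
  shows "real (card {n \<in> {1..N}. P n}) = (\<Sum>n=1..N. of_bool (P n))"
proof -
  have "real (card {n \<in> {1..N}. P n}) = (\<Sum>n | n \<in> {1..N} \<and> P n. 1)"
    by (simp only: real_of_card)
  also have "\<dots> = (\<Sum>n=1..N. if P n then 1 else 0)"
    by (rule sum.inter_filter) simp
  finally show ?thesis
    by (simp only: of_bool_def)
qed

lemma proportion_cong:
  assumes "\<And>n. n \<ge> 1 \<Longrightarrow> P n \<longleftrightarrow> Q n"
  shows "proportion P = proportion Q"
proof
  fix N
  have "{n \<in> {1..N}. P n} = {n \<in> {1..N}. Q n}"
    using assms by auto
  then show "proportion P N = proportion Q N"
    by (simp add: proportion_def)
qed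

lemma proportion_disj:
  assumes "\<And>n. \<not> (P n \<and> Q n)"
  shows "proportion (\<lambda>n. P n \<or> Q n) = (\<lambda>N. proportion P N + proportion Q N)"
proof
  fix N
  have "of_bool (P n \<or> Q n) = (of_bool (P n) + of_bool (Q n) :: real)" for n
    using assms[of n] by auto
  then show "proportion (\<lambda>n. P n \<or> Q n) N = proportion P N + proportion Q N"
    unfolding proportion_def card_filter_eq_sum by (simp only: sum.distrib add_divide_distrib)
qed

text \<open>
  Weyl's equidistribution theorem. By \<open>of_bool_frac_mem_interval\<close>, the proportion differs from
  \<open>b - a\<close> by the difference of the means of \<open>frac\<close> along two orbits of the rotation. The maximum in the limit
  covers the empty interval, which lets intersections of intervals be treated without case distinctions.
\<close>

theorem frac_multiples_equidistributed:
  fixes \<theta> a b :: real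
  assumes "\<theta> \<notin> \<rat>" "0 \<le> a" "b \<le> 1"
  shows "proportion (\<lambda>n. a \<le> frac (real n * \<theta>) \<and> frac (real n * \<theta>) < b) \<longlonglongrightarrow> max 0 (b - a)"
proof (cases "a \<le> b")
  case True
  define D where "D N = ((\<Sum>n=1..N. frac (real n * \<theta> + - b)) - (\<Sum>n=1..N. frac (real n * \<theta> + - a))) / real N" for N
  have "proportion (\<lambda>n. a \<le> frac (real n * \<theta>) \<and> frac (real n * \<theta>) < b) N = (b - a) + D N" if "N \<ge> 1" for N
    unfolding proportion_def card_filter_eq_sum D_def of_bool_frac_mem_interval[OF assms(2) True assms(3)]
    using that by (simp add: sum.distrib sum_subtractf field_simps)
  then have ev: "\<forall>\<^sub>F N in sequentially. (b - a) + D N = proportion (\<lambda>n. a \<le> frac (real n * \<theta>) \<and> frac (real n * \<theta>) < b) N"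
    by (intro eventually_sequentiallyI[of 1]) simp
  have "(\<lambda>N. (b - a) + D N) \<longlonglongrightarrow> (b - a) + 0"
    unfolding D_def by (intro tendsto_intros mean_frac_shift_diff_tendsto_0 assms)
  then show ?thesis
    using True Lim_transform_eventually[OF _ ev] by simp
next
  case False
  then have "proportion (\<lambda>n. a \<le> frac (real n * \<theta>) \<and> frac (real n * \<theta>) < b) = (\<lambda>N. 0)"
    by (intro ext) (auto simp: proportion_def)
  then show ?thesis
    using False by simp
qed

section \<open>Affine images of an equidistributed sequence\<close>

lemma has_integral_indicator_Ico:
  fixes s t A B :: real
  shows "(indicator {A..<B} has_integral max 0 (min t B - max s A)) {s..t}"
proof -
  have "((\<lambda>x. 1::real) has_integral max 0 (min t B - max s A)) {max s A..min t B}"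
  proof (cases "max s A \<le> min t B")
    case True
    then show ?thesis
      using has_integral_const_real[of "1::real" "max s A" "min t B"] by (simp only: content_real) simp
  next
    case False
    then have "max 0 (min t B - max s A) = 0" "{max s A..min t B} = {}"
      by (linarith, intro atLeastatMost_empty) linarith
    then show ?thesis by (simp only: has_integral_empty)
  qed
  then have "((\<lambda>x. if x \<in> {A..B} then 1 else 0 :: real) has_integral max 0 (min t B - max s A)) {s..t}"
  proof -
    have "{A..B} \<inter> {s..t} = {max s A..min t B}" by auto
    with \<open>((\<lambda>x. 1::real) has_integral _) _\<close> show ?thesis
      by (simp only: has_integral_restrict_Int)
  qed
  then show ?thesis
    by (rule has_integral_spike_finite[of "{B}", rotated 2]) (auto simp: indicator_def)
qed

text \<open>
  The condition on \<open>k * u - c\<close> cuts out an interval of values of \<open>u\<close>, whose length is \<open>1 / k\<close> times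
  that of its image. Stating the limit as an integral of a density makes the contributions of
  several pieces add up to the integral of the sum of the densities.
\<close>

lemma affine_piece_distribution:
  fixes \<theta> p q k c s t :: real
  assumes "\<theta> \<notin> \<rat>" "0 \<le> p" "q \<le> 1" "k > 0"
  shows "proportion (\<lambda>n. (p \<le> frac (real n * \<theta>) \<and> frac (real n * \<theta>) < q) \<and>
             s \<le> k * frac (real n * \<theta>) - c \<and> k * frac (real n * \<theta>) - c < t)
           \<longlonglongrightarrow> integral {s..t} (\<lambda>x. indicator {k * p - c..<k * q - c} x / k)"
proof -
  have eq: "(p \<le> u \<and> u < q) \<and> s \<le> k * u - c \<and> k * u - c < t \<longleftrightarrow>
        max p ((s + c) / k) \<le> u \<and> u < min q ((t + c) / k)" for u
    using \<open>k > 0\<close> by (auto simp: field_simps)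
  have scale: "max 0 (min q ((t + c) / k) - max p ((s + c) / k)) =
        max 0 (min t (k * q - c) - max s (k * p - c)) / k"
  proof -
    have "min t (k * q - c) = k * min q ((t + c) / k) - c"
      "max s (k * p - c) = k * max p ((s + c) / k) - c"
      using \<open>k > 0\<close> by (auto simp: min_def max_def field_simps)
    then have "min t (k * q - c) - max s (k * p - c) = k * (min q ((t + c) / k) - max p ((s + c) / k))"
      by (simp add: algebra_simps)
    then show ?thesis
      using \<open>k > 0\<close> by (simp add: max_def zero_le_mult_iff)
  qed
  have "proportion (\<lambda>n. max p ((s + c) / k) \<le> frac (real n * \<theta>) \<and> frac (real n * \<theta>) < min q ((t + c) / k))
          \<longlonglongrightarrow> max 0 (min q ((t + c) / k) - max p ((s + c) / k))"
    using assms by (intro frac_multiples_equidistributed) auto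
  moreover have "integral {s..t} (\<lambda>x. indicator {k * p - c..<k * q - c} x / k) =
      max 0 (min t (k * q - c) - max s (k * p - c)) / k"
    by (intro integral_unique has_integral_divide has_integral_indicator_Ico)
  ultimately show ?thesis
    unfolding eq scale by (simp only:)
qed

section \<open>The Benford error as a sum over a rotation\<close>

lemma leading_digit_eq_iff:
  assumes "x > 0" "d \<ge> 1"
  shows "leading_digit x = d \<longleftrightarrow> log 10 (real d) \<le> frac (log 10 x) \<and> frac (log 10 x) < log 10 (real d + 1)"
proof -
  have "x = 10 powr log 10 x"
    using assms by simp
  then have y: "x / 10 powi \<lfloor>log 10 x\<rfloor> = 10 powr frac (log 10 x)"
    by (simp add: frac_def powr_diff powr_real_of_int')
  have "leading_digit x = d \<longleftrightarrow> \<lfloor>10 powr frac (log 10 x)\<rfloor> = int d"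
    unfolding leading_digit_def y using assms by auto
  also have "\<dots> \<longleftrightarrow> real d \<le> 10 powr frac (log 10 x) \<and> 10 powr frac (log 10 x) < real d + 1"
    by (simp add: floor_eq_iff)
  finally show ?thesis
    using assms by (simp add: log_le_iff less_log_iff)
qed

lemma benford_error_eq_sum:
  assumes "1 \<le> d" "d \<le> 9"
  shows "benford_error d N =
    (\<Sum>n=1..N. frac (real n * alpha - log 10 (real d + 1)) - frac (real n * alpha - log 10 (real d)))"
proof -
  have l: "log 10 (real d + 1) - log 10 (real d) = log 10 (1 + 1 / real d)"
  proof -
    have "1 + 1 / real d = (real d + 1) / real d"
      using assms by (simp add: field_simps)
    then show ?thesis
      using assms by (simp add: log_divide)
  qed
  have b: "0 \<le> log 10 (real d)" "log 10 (real d) \<le> log 10 (real d + 1)" "log 10 (real d + 1) \<le> 1"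
    using assms by auto
  have "of_bool (leading_digit (2 ^ n) = d) = log 10 (1 + 1 / real d) +
      (frac (real n * alpha - log 10 (real d + 1)) - frac (real n * alpha - log 10 (real d)))" for n
  proof -
    have "log 10 (2 ^ n) = real n * alpha"
      by (simp add: alpha_def log_nat_power)
    then show ?thesis
      using of_bool_frac_mem_interval[OF b, of "real n * alpha"]
      by (simp only: leading_digit_eq_iff[OF _ assms(1)] l zero_less_power zero_less_numeral)
  qed
  then show ?thesis
    unfolding benford_error_def card_filter_eq_sum by (simp add: sum.distrib)
qed

text \<open>
  These bounds come from \<open>2 ^ 3 < 10 < 2 ^ 4\<close>. They fix the order of the breakpoints of \<open>f4\<close>
  and of the three pieces of the error for the digit \<open>4\<close>.
\<close>

lemma alpha_bounds: "1 / 4 < alpha" "alpha < 1 / 3"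
proof -
  have "log 10 10 < log 10 (2 ^ 4 :: real)" "log 10 (2 ^ 3 :: real) < log 10 10"
    by (subst log_less_cancel_iff; simp)+
  then show "1 / 4 < alpha" "alpha < 1 / 3"
    unfolding alpha_def by (simp_all only: log_nat_power) auto
qed

text \<open>Otherwise \<open>2 ^ n = 10 ^ m\<close> with \<open>m > 0\<close>, but the prime \<open>5\<close> divides only the right-hand side.\<close>

lemma alpha_irrational: "alpha \<notin> \<rat>"
proof
  assume "alpha \<in> \<rat>"
  then obtain p q :: int where pq: "q > 0" "alpha = of_int p / of_int q"
    by (meson Rats_cases')
  moreover have "p > 0"
    using pq alpha_bounds by (smt (verit) of_int_0_less_iff zero_less_divide_iff divide_pos_pos)
  ultimately obtain m n :: nat where mn: "m > 0" "alpha = real m / real n" "n > 0"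
    by (metis of_int_of_nat_eq pos_int_cases)
  have "log 10 (2 ^ n) = log 10 (10 ^ m)"
    using mn by (simp add: alpha_def log_nat_power field_simps)
  then have "(2::real) ^ n = 10 ^ m"
    by (subst (asm) log_inj[THEN inj_on_eq_iff]) auto
  then have "(2::nat) ^ n = 10 ^ m"
    by (metis of_nat_eq_iff of_nat_numeral of_nat_power)
  moreover have "(5::nat) dvd 10 ^ m"
    using \<open>m > 0\<close> by (intro dvd_power_le[of 5 10 1 m, simplified]) auto
  ultimately have "(5::nat) dvd 2 ^ n"
    by simp
  then have "(5::nat) dvd 2"
    by (rule prime_dvd_power[rotated]) simp
  then show False
    by simp
qed

lemma benford_error_1_eq: "benford_error 1 N = - frac (real N * alpha)"
proof -
  have "benford_error 1 N = (\<Sum>n=1..N. frac (real n * alpha - alpha) - frac (real n * alpha))"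
    by (subst benford_error_eq_sum) (auto simp: alpha_def)
  also have "\<dots> = - frac (real N * alpha)"
    by (induction N) (auto simp: algebra_simps)
  finally show ?thesis .
qed

text \<open>
  Since \<open>log 10 5 = 1 - alpha\<close> and \<open>log 10 4 = 2 * alpha\<close>, the summand is
  \<open>frac ((n + 1) * alpha) - frac ((n - 2) * alpha)\<close>. Telescoping with step 3 leaves three terms at the
  upper end. The terms at the lower end have the arguments \<open>alpha\<close>, \<open>0\<close> and \<open>- alpha\<close>, and their
  sum is 1.
\<close>

lemma benford_error_4_eq:
  "benford_error 4 N =
     frac (real N * alpha - alpha) + frac (real N * alpha) + frac (real N * alpha + alpha) - 1"
proof -
  have "log 10 (10 / 2) = 1 - alpha"
    unfolding alpha_def by (subst log_divide) simp_all
  moreover have "log 10 (2 ^ 2) = 2 * alpha"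
    unfolding alpha_def by (subst log_nat_power) simp_all
  ultimately have l: "log 10 5 = 1 - alpha" "log 10 4 = 2 * alpha"
    by simp_all
  have "benford_error 4 N = (\<Sum>n=1..N. frac (real n * alpha + alpha) - frac (real n * alpha - 2 * alpha))"
  proof -
    have "frac (x - (1 - alpha)) = frac (x + alpha)" for x
      using frac_1_eq[of "x - (1 - alpha)"] by (simp add: algebra_simps)
    then show ?thesis
      by (subst benford_error_eq_sum) (simp_all add: l)
  qed
  also have "\<dots> = frac (real N * alpha - alpha) + frac (real N * alpha) + frac (real N * alpha + alpha) - 1"
  proof (induction N)
    case 0
    have "alpha \<notin> \<int>"
      using alpha_irrational Ints_subset_Rats by blast
    then show ?case
      by (simp add: frac_neg)
  qed (auto simp: algebra_simps)
  finally show ?thesis .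
qed

lemma benford_error_4_piecewise:
  "benford_error 4 N =
     (let u = frac (real N * alpha)
      in if u < alpha then 3 * u else if u < 1 - alpha then 3 * u - 1 else 3 * u - 2)"
proof -
  have "frac (real N * alpha + alpha) = frac (real N * alpha - (1 - alpha))"
    using frac_1_eq[of "real N * alpha - (1 - alpha)"] by (simp add: algebra_simps)
  then show ?thesis
    using alpha_bounds unfolding benford_error_4_eq Let_def
    by (auto simp: frac_diff_of_bool)
qed

section \<open>The limiting distributions\<close>

lemma benford_error_1_distribution:
  "proportion (\<lambda>n. s \<le> benford_error 1 n \<and> benford_error 1 n < t) \<longlonglongrightarrow> integral {s..t} f1"
proof -
  have irr: "- alpha \<notin> \<rat>"
    using alpha_irrational by simp
  \<comment> \<open>The error is \<open>- frac (n * alpha)\<close>. Rotating by \<open>- alpha\<close> instead gives a piece of positive slope and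
    keeps the half-open interval of values closed on the left.\<close>
  have e: "benford_error 1 n = 1 * frac (real n * (- alpha)) - 1" if "n \<ge> 1" for n
  proof -
    have "real n * alpha \<notin> \<int>"
    proof
      assume "real n * alpha \<in> \<int>"
      then have "real n * alpha / real n \<in> \<rat>"
        using Ints_subset_Rats by (intro Rats_divide) auto
      then show False
        using that alpha_irrational by simp
    qed
    then show ?thesis
      using frac_neg[of "real n * alpha"] by (simp add: benford_error_1_eq del: One_nat_def)
  qed
  have "proportion (\<lambda>n. s \<le> benford_error 1 n \<and> benford_error 1 n < t) =
    proportion (\<lambda>n. (0 \<le> frac (real n * (- alpha)) \<and> frac (real n * (- alpha)) < 1) \<and>
       s \<le> 1 * frac (real n * (- alpha)) - 1 \<and> 1 * frac (real n * (- alpha)) - 1 < t)"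
    by (rule proportion_cong) (simp only: e frac_ge_0 frac_lt_1 simp_thms)
  \<comment> \<open>The density of the piece vanishes at the right endpoint \<open>0\<close>, where \<open>f1\<close> is \<open>1\<close>.\<close>
  moreover have "integral {s..t} f1 = integral {s..t} (\<lambda>x. indicator {1 * 0 - 1..<1 * 1 - 1} x / 1)"
    by (rule integral_spike[of "{0}"]) (auto simp: f1_def indicator_def)
  ultimately show ?thesis
    using affine_piece_distribution[OF irr, of 0 1 1 s 1 t] by simp
qed

lemma benford_error_4_distribution:
  "proportion (\<lambda>n. s \<le> benford_error 4 n \<and> benford_error 4 n < t) \<longlonglongrightarrow> integral {s..t} f4"
proof -
  \<comment> \<open>\<open>P p q c n\<close>: the point lies on the piece from \<open>p\<close> to \<open>q\<close>, on which the error is \<open>3 * u - c\<close>,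
    and this value is in the prescribed range; \<open>g p q c\<close> is the density of that piece.\<close>
  define P where "P p q c n \<longleftrightarrow> (p \<le> frac (real n * alpha) \<and> frac (real n * alpha) < q) \<and>
      s \<le> 3 * frac (real n * alpha) - c \<and> 3 * frac (real n * alpha) - c < t" for p q c and n :: nat
  define g :: "real \<Rightarrow> real \<Rightarrow> real \<Rightarrow> real \<Rightarrow> real"
    where "g p q c = (\<lambda>x. indicator {3 * p - c..<3 * q - c} x / 3)" for p q c
  have lim: "proportion (P p q c) \<longlonglongrightarrow> integral {s..t} (g p q c)" if "0 \<le> p" "q \<le> 1" for p q c
    unfolding P_def g_def using that by (intro affine_piece_distribution alpha_irrational) auto
  have int: "g p q c integrable_on {s..t}" for p q c
    unfolding g_def
    by (rule has_integral_integrable, rule has_integral_divide, rule has_integral_indicator_Ico)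
  have "proportion (\<lambda>n. s \<le> benford_error 4 n \<and> benford_error 4 n < t) =
      proportion (\<lambda>n. P 0 alpha 0 n \<or> (P alpha (1 - alpha) 1 n \<or> P (1 - alpha) 1 2 n))"
    by (rule proportion_cong)
      (use alpha_bounds in \<open>auto simp: P_def benford_error_4_piecewise Let_def frac_lt_1\<close>)
  also have "\<dots> = (\<lambda>N. proportion (P 0 alpha 0) N +
      (proportion (P alpha (1 - alpha) 1) N + proportion (P (1 - alpha) 1 2) N))"
  proof -
    have d: "\<not> (P 0 alpha 0 n \<and> (P alpha (1 - alpha) 1 n \<or> P (1 - alpha) 1 2 n))"
      "\<not> (P alpha (1 - alpha) 1 n \<and> P (1 - alpha) 1 2 n)" for n
      using alpha_bounds unfolding P_def by linarith+
    show ?thesis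
      using proportion_disj[of "P 0 alpha 0" "\<lambda>n. P alpha (1 - alpha) 1 n \<or> P (1 - alpha) 1 2 n", OF d(1)]
        proportion_disj[of "P alpha (1 - alpha) 1" "P (1 - alpha) 1 2", OF d(2)]
      by simp
  qed
  finally have "proportion (\<lambda>n. s \<le> benford_error 4 n \<and> benford_error 4 n < t) \<longlonglongrightarrow>
      integral {s..t} (g 0 alpha 0) +
      (integral {s..t} (g alpha (1 - alpha) 1) + integral {s..t} (g (1 - alpha) 1 2))"
    using alpha_bounds by (auto intro!: tendsto_add lim)
  moreover have "integral {s..t} (g 0 alpha 0) +
      (integral {s..t} (g alpha (1 - alpha) 1) + integral {s..t} (g (1 - alpha) 1 2)) =
      integral {s..t} (\<lambda>x. g 0 alpha 0 x + (g alpha (1 - alpha) 1 x + g (1 - alpha) 1 2 x))"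
    by (simp add: int integrable_add integral_add)
  moreover have "(\<lambda>x. g 0 alpha 0 x + (g alpha (1 - alpha) 1 x + g (1 - alpha) 1 2 x)) = f4"
    using alpha_bounds by (auto simp: g_def f4_def indicator_def fun_eq_iff)
  ultimately show ?thesis by (simp only:)
qed

theorem theorem4:
  fixes s t :: real
  assumes "s < t"
  shows "((\<lambda>N. real (card {n \<in> {1..N}. s \<le> benford_error 1 n \<and> benford_error 1 n < t}) / real N)
            \<longlonglongrightarrow> integral {s..t} f1) \<and>
         ((\<lambda>N. real (card {n \<in> {1..N}. s \<le> benford_error 4 n \<and> benford_error 4 n < t}) / real N)
            \<longlonglongrightarrow> integral {s..t} f4)"
  using benford_error_1_distribution[of s t] benford_error_4_distribution[of s t]
  unfolding proportion_def[abs_def] ..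

end
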